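(* Assume that $\sum_{k\ge1}\frac1{a_k}<\infty$. Then the sequence $\pi$ is generic for $\nu'$, i.e. for any cylinder set $C\subset Y$, $$\frac1N\sum_{0\le n<N}\mathbf{1}_C(S^n\pi)\longrightarrow\nu'(C)\qquad\text{as }N\to\infty.$$
   Context: $\mathbb{N}^*=\{1,2,3,\ldots\}$. $(a_k)_{k\ge1}$ is a sequence of pairwise relatively prime integers $a_k\ge2$. For $n\in\mathbb{N}^*$, $\delta_n=|\{k\ge1:a_k\text{ divides }n\}|$ and $\pi_n=(-1)^{\delta_n}$; $\pi=(\pi_n)_{n\in\mathbb{N}^*}$. $Y=\{-1,1\}^{\mathbb{N}^*}$ with the shift $(Sy)_n=y_{n+1}$. A cylinder set is a subset of $Y$ obtained by prescribing the values of finitely many coordinates. $\Omega'=\prod_{k\ge1}\mathbb{Z}/a_k\mathbb{Z}$ with normalized Haar measure $\mathbb{P}'$, and $T'(\omega'_k)_{k\ge1}=(\omega'_k+1)_{k\ge1}$. For $\omega'\in\Omega'$, $\Delta(\omega')=|\{k\ge1:\omega'_k=0\}|\in\{0,1,2,\ldots\}\cup\{\infty\}$. When $\sum_k1/a_k<\infty$, $\Delta(\omega')<\infty$ for $\mathbb{P}'$-almost every $\omega'$, and the map $\psi:\Omega'\to Y$, $\psi(\omega')=\bigl((-1)^{\Delta(T'^n\omega')}\bigr)_{n\in\mathbb{N}^*}$, is defined $\mathbb{P}'$-almost surely. $\nu'$ is the pushforward of $\mathbb{P}'$ by $\psi$. *)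

theory Defs
  imports
    "HOL-Probability.Probability"
    "HOL-Algebra.Elementary_Groups"
    "HOL-Algebra.Product_Groups"
    "HOL-Library.Extended_Nat"
begin

text \<open>
  Sequences indexed by the positive integers are functions on \<open>nat\<close>. Points of the product
  spaces below are extensional functions on \<open>{1..}\<close>; of the sequence \<open>a\<close> only the values
  \<open>a k\<close> with \<open>k \<ge> 1\<close> are used.
\<close>

definition delta :: "(nat \<Rightarrow> nat) \<Rightarrow> nat \<Rightarrow> nat" where
  "delta a n = card {k. 1 \<le> k \<and> a k dvd n}"

definition pi_seq :: "(nat \<Rightarrow> nat) \<Rightarrow> nat \<Rightarrow> int" where
  "pi_seq a = (\<lambda>n\<in>{1..}. (- 1) ^ delta a n)"

definition Y :: "(nat \<Rightarrow> int) set" where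
  "Y = (\<Pi>\<^sub>E n\<in>{1..}. {- 1, 1})"

definition Y_measurable :: "(nat \<Rightarrow> int) measure" where
  "Y_measurable = (\<Pi>\<^sub>M n\<in>{1..}. count_space {- 1, 1})"

definition shift :: "(nat \<Rightarrow> int) \<Rightarrow> nat \<Rightarrow> int" where
  "shift y = (\<lambda>n\<in>{1..}. y (n + 1))"

definition cylinder :: "(nat \<Rightarrow> int) set \<Rightarrow> bool" where
  "cylinder C \<longleftrightarrow>
     (\<exists>F v. finite F \<and> F \<subseteq> {1..} \<and> (\<forall>n\<in>F. v n \<in> {- 1, 1}) \<and> C = {y \<in> Y. \<forall>n\<in>F. y n = v n})"

definition generic :: "(nat \<Rightarrow> int) \<Rightarrow> (nat \<Rightarrow> int) measure \<Rightarrow> bool" where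
  "generic y \<mu> \<longleftrightarrow>
     (\<forall>C. cylinder C \<longrightarrow>
        (\<lambda>N. (1 / real N) * (\<Sum>n<N. indicator C ((shift ^^ n) y))) \<longlonglongrightarrow> measure \<mu> C)"

definition Omega :: "(nat \<Rightarrow> nat) \<Rightarrow> (nat \<Rightarrow> int) monoid" where
  "Omega a = product_group {1..} (\<lambda>k. integer_mod_group (a k))"

text \<open>
  The normalized Haar measure of the compact group \<open>Omega a\<close> is the product of the normalized
  Haar measures, i.e. the uniform distributions, of the finite factors. The lemma
  \<open>haar_translation_invariant\<close> below confirms that it is the translation-invariant probability
  measure.
\<close>

definition haar :: "(nat \<Rightarrow> nat) \<Rightarrow> (nat \<Rightarrow> int) measure" where
  "haar a = (\<Pi>\<^sub>M k\<in>{1..}. uniform_count_measure (carrier (integer_mod_group (a k))))"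

definition T :: "(nat \<Rightarrow> nat) \<Rightarrow> (nat \<Rightarrow> int) \<Rightarrow> nat \<Rightarrow> int" where
  "T a \<omega> = (\<lambda>k\<in>{1..}. \<omega> k \<otimes>\<^bsub>integer_mod_group (a k)\<^esub> 1)"

definition Delta :: "(nat \<Rightarrow> int) \<Rightarrow> enat" where
  "Delta \<omega> = (let Z = {k. 1 \<le> k \<and> \<omega> k = 0} in if finite Z then enat (card Z) else \<infinity>)"

text \<open>
  Where \<open>Delta\<close> is infinite, which happens only on a null set if \<open>\<Sum>k. 1 / a k\<close> converges,
  \<open>the_enat\<close> returns an unspecified number.
\<close>

definition psi :: "(nat \<Rightarrow> nat) \<Rightarrow> (nat \<Rightarrow> int) \<Rightarrow> nat \<Rightarrow> int" where
  "psi a \<omega> = (\<lambda>n\<in>{1..}. (- 1) ^ the_enat (Delta ((T a ^^ n) \<omega>)))"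

definition nu :: "(nat \<Rightarrow> nat) \<Rightarrow> (nat \<Rightarrow> int) measure" where
  "nu a = distr (haar a) Y_measurable (psi a)"


lemma finite_delta:
  fixes a :: "nat \<Rightarrow> nat"
  assumes a: "\<And>k. 1 \<le> k \<Longrightarrow> 2 \<le> a k"
    and cop: "pairwise (\<lambda>i j. coprime (a i) (a j)) {1..}"
    and n: "1 \<le> n"
  shows "finite {k. 1 \<le> k \<and> a k dvd n}"
proof (rule inj_on_finite[where f = a and B = "{..n}"])
  show "inj_on a {k. 1 \<le> k \<and> a k dvd n}"
  proof (rule inj_onI, rule ccontr)
    fix i j assume ij: "i \<in> {k. 1 \<le> k \<and> a k dvd n}" "j \<in> {k. 1 \<le> k \<and> a k dvd n}"
      "a i = a j" "i \<noteq> j"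
    then have "coprime (a i) (a j)"
      using pairwiseD[OF cop, of i j] by simp
    then show False
      using a[of i] ij by simp
  qed
  show "a ` {k. 1 \<le> k \<and> a k dvd n} \<subseteq> {..n}"
    using n by (auto intro: dvd_imp_le)
qed simp

lemma prob_space_factor:
  assumes "2 \<le> (m :: nat)"
  shows "prob_space (uniform_count_measure (carrier (integer_mod_group m)))"
  using assms by (intro prob_space_uniform_count_measure) (auto simp: carrier_integer_mod_group)

lemma prob_space_haar:
  assumes "\<And>k. 1 \<le> k \<Longrightarrow> 2 \<le> a k"
  shows "prob_space (haar a)"
  unfolding haar_def using assms by (intro prob_space_PiM prob_space_factor) auto

lemma space_haar: "space (haar a) = carrier (Omega a)"
  by (simp add: haar_def Omega_def space_PiM space_uniform_count_measure)

lemma sets_haar: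
  "sets (haar a) = sets (\<Pi>\<^sub>M k\<in>{1..}. count_space (carrier (integer_mod_group (a k))))"
  unfolding haar_def by (intro sets_PiM_cong sets_uniform_count_measure_count_space refl)

lemma group_Omega: "group (Omega a)"
  by (simp add: Omega_def)

lemma T_eq_translation:
  assumes "\<And>k. 1 \<le> k \<Longrightarrow> 2 \<le> a k"
  shows "(\<lambda>k\<in>{1..}. 1) \<in> carrier (Omega a)" "T a \<omega> = \<omega> \<otimes>\<^bsub>Omega a\<^esub> (\<lambda>k\<in>{1..}. 1)"
proof -
  have "1 < int (a k)" if "1 \<le> k" for k
    using assms[OF that] by simp
  then show "(\<lambda>k\<in>{1..}. 1) \<in> carrier (Omega a)"
    by (auto simp: Omega_def carrier_integer_mod_group)
qed (auto simp: Omega_def T_def intro!: restrict_ext)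

lemma translation_measurable:
  assumes "g \<in> carrier (Omega a)"
  shows "(\<lambda>\<omega>. \<omega> \<otimes>\<^bsub>Omega a\<^esub> g) \<in> haar a \<rightarrow>\<^sub>M haar a"
proof -
  let ?U = "\<lambda>k. uniform_count_measure (carrier (integer_mod_group (a k)))"
  have "(\<lambda>x. x \<otimes>\<^bsub>integer_mod_group (a k)\<^esub> g k) \<in> ?U k \<rightarrow>\<^sub>M ?U k" if "1 \<le> k" for k
  proof -
    have "g k \<in> carrier (integer_mod_group (a k))"
      using assms that by (auto simp: Omega_def)
    then show ?thesis
      using group.is_monoid[of "integer_mod_group (a k)"]
      by (auto simp: measurable_def space_uniform_count_measure sets_uniform_count_measure
          monoid.m_closed simp del: mult_integer_mod_group)
  qed
  then show ?thesis
    unfolding haar_def Omega_def mult_product_group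
    by (intro measurable_restrict) (auto intro: measurable_compose[OF measurable_component_singleton])
qed

lemma haar_translation_invariant:
  assumes a: "\<And>k. 1 \<le> k \<Longrightarrow> 2 \<le> a k" and g: "g \<in> carrier (Omega a)"
  shows "distr (haar a) (haar a) (\<lambda>\<omega>. \<omega> \<otimes>\<^bsub>Omega a\<^esub> g) = haar a"
proof -
  let ?G = "\<lambda>k. integer_mod_group (a k)"
  let ?U = "\<lambda>k. uniform_count_measure (carrier (?G k))"
  let ?t = "\<lambda>\<omega>. \<omega> \<otimes>\<^bsub>Omega a\<^esub> g"
  have t: "?t \<in> haar a \<rightarrow>\<^sub>M haar a"
    by (rule translation_measurable[OF g])
  have pr: "prob_space (?U k)" if "k \<in> {1..}" for k
    using a that by (intro prob_space_factor) auto
  have gk: "g k \<in> carrier (?G k)" if "k \<in> {1..}" for k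
    using g that by (auto simp: Omega_def)
  have fin: "finite (carrier (?G k))" if "k \<in> {1..}" for k
    using a[of k] that by (auto simp: carrier_integer_mod_group)
  show ?thesis
  proof (rule measure_eqI_PiM_infinite)
    show "sets (distr (haar a) (haar a) ?t) = sets (PiM {1..} ?U)" "sets (haar a) = sets (PiM {1..} ?U)"
      by (simp_all add: haar_def)
    interpret prob_space "haar a" by (rule prob_space_haar[OF a])
    show "finite_measure (distr (haar a) (haar a) ?t)"
      by (intro finite_measure_distr t)
    fix A J assume J: "finite J" "J \<subseteq> {1..}" and A: "\<And>k. k \<in> J \<Longrightarrow> A k \<in> sets (?U k)"
    define B where "B k = {x \<in> carrier (?G k). x \<otimes>\<^bsub>?G k\<^esub> g k \<in> A k}" for k
    have Asub: "A k \<subseteq> carrier (?G k)" if "k \<in> J" for k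
      using A[OF that] by (auto simp: sets_uniform_count_measure)
    have card: "card (B k) = card (A k)" if k: "k \<in> J" for k
    proof -
      interpret G: group "?G k" by simp
      note g' = gk[OF subsetD[OF J(2) k]]
      have cl: "x \<in> carrier (?G k)" if "x \<in> A k" for x
        using Asub[OF k] that by blast
      have "bij_betw (\<lambda>x. x \<otimes>\<^bsub>?G k\<^esub> g k) (B k) (A k)"
      proof (rule bij_betwI[where g = "\<lambda>y. y \<otimes>\<^bsub>?G k\<^esub> inv\<^bsub>?G k\<^esub> g k"])
        have 1: "y \<otimes>\<^bsub>?G k\<^esub> inv\<^bsub>?G k\<^esub> g k \<otimes>\<^bsub>?G k\<^esub> g k = y" if "y \<in> A k" for y
          using G.inv_solve_right[of "y \<otimes>\<^bsub>?G k\<^esub> inv\<^bsub>?G k\<^esub> g k" y "g k"]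
            G.m_closed[OF cl[OF that] G.inv_closed[OF g']] cl[OF that] g' by metis
        show "(\<lambda>x. x \<otimes>\<^bsub>?G k\<^esub> g k) \<in> B k \<rightarrow> A k"
          by (auto simp only: B_def)
        show "(\<lambda>y. y \<otimes>\<^bsub>?G k\<^esub> inv\<^bsub>?G k\<^esub> g k) \<in> A k \<rightarrow> B k"
          unfolding B_def using 1 cl g' by (intro Pi_I CollectI conjI) (metis G.m_closed G.inv_closed, metis)
        show "y \<otimes>\<^bsub>?G k\<^esub> inv\<^bsub>?G k\<^esub> g k \<otimes>\<^bsub>?G k\<^esub> g k = y" if "y \<in> A k" for y
          by (rule 1[OF that])
        show "x \<otimes>\<^bsub>?G k\<^esub> g k \<otimes>\<^bsub>?G k\<^esub> inv\<^bsub>?G k\<^esub> g k = x" if "x \<in> B k" for x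
          using that g' unfolding B_def
          by (metis (no_types, lifting) G.inv_closed G.m_assoc G.r_inv G.r_one mem_Collect_eq)
      qed
      then show ?thesis by (rule bij_betw_same_card)
    qed
    have emb: "prod_emb {1..} ?U J (Pi\<^sub>E J A) \<in> sets (haar a)"
      unfolding haar_def using J A by (intro sets_PiM_I) auto
    have "?t -` prod_emb {1..} ?U J (Pi\<^sub>E J A) \<inter> space (haar a) = prod_emb {1..} ?U J (Pi\<^sub>E J B)"
    proof -
      have "?t \<omega> \<in> carrier (Omega a)" if "\<omega> \<in> carrier (Omega a)" for \<omega>
        using that g by (simp only: monoid.m_closed group.is_monoid[OF group_Omega])
      moreover have "space (PiM {1..} ?U) = carrier (Omega a)"
        using space_haar by (simp add: haar_def)
      moreover have "?t \<omega> k = \<omega> k \<otimes>\<^bsub>?G k\<^esub> g k" if "k \<in> J" for \<omega> k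
        using J that by (auto simp: Omega_def)
      moreover have "\<omega> k \<in> carrier (?G k)" if "\<omega> \<in> carrier (Omega a)" "k \<in> J" for \<omega> k
        using J that by (auto simp: Omega_def PiE_iff)
      moreover have "prod_emb {1..} ?U J (Pi\<^sub>E J X) = {\<omega> \<in> space (PiM {1..} ?U). \<forall>k\<in>J. \<omega> k \<in> X k}" for X
        using J by (auto simp: prod_emb_def space_PiM PiE_iff extensional_def)
      ultimately show ?thesis
        by (simp add: B_def space_haar set_eq_iff) blast
    qed
    then have "emeasure (distr (haar a) (haar a) ?t) (prod_emb {1..} ?U J (Pi\<^sub>E J A))
        = emeasure (haar a) (prod_emb {1..} ?U J (Pi\<^sub>E J B))"
      using t emb by (simp add: emeasure_distr)
    also have "\<dots> = (\<Prod>k\<in>J. emeasure (?U k) (B k))"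
      unfolding haar_def using J pr by (intro emeasure_PiM_emb) (auto simp: B_def sets_uniform_count_measure)
    also have "\<dots> = (\<Prod>k\<in>J. emeasure (?U k) (A k))"
    proof (rule prod.cong[OF refl])
      fix k assume k: "k \<in> J"
      have "B k \<subseteq> carrier (?G k)"
        by (auto simp: B_def)
      then show "emeasure (?U k) (B k) = emeasure (?U k) (A k)"
        using J Asub[OF k] fin[of k] k card[OF k] by (auto simp: emeasure_uniform_count_measure)
    qed
    also have "\<dots> = emeasure (haar a) (prod_emb {1..} ?U J (Pi\<^sub>E J A))"
      unfolding haar_def using J pr A by (intro emeasure_PiM_emb[symmetric]) auto
    finally show "emeasure (distr (haar a) (haar a) ?t) (prod_emb {1..} ?U J (Pi\<^sub>E J A))
        = emeasure (haar a) (prod_emb {1..} ?U J (Pi\<^sub>E J A))" .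
  qed
qed

lemma psi_measurable:
  assumes a: "\<And>k. 1 \<le> k \<Longrightarrow> 2 \<le> a k"
  shows "psi a \<in> haar a \<rightarrow>\<^sub>M Y_measurable"
proof -
  let ?Z = "\<lambda>\<omega>. {k. 1 \<le> k \<and> \<omega> k = (0::int)}"
  have one: "(\<lambda>k\<in>{1..}. 1) \<in> carrier (Omega a)"
    using a by (rule T_eq_translation(1))
  have T_eq: "T a = (\<lambda>\<omega>. \<omega> \<otimes>\<^bsub>Omega a\<^esub> (\<lambda>k\<in>{1..}. 1))"
  proof (rule ext)
    show "T a \<omega> = \<omega> \<otimes>\<^bsub>Omega a\<^esub> (\<lambda>k\<in>{1..}. 1)" for \<omega>
      using a by (rule T_eq_translation(2))
  qed
  have Tm: "T a \<in> haar a \<rightarrow>\<^sub>M haar a"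
    unfolding T_eq by (rule translation_measurable[OF one])
  have Tn: "(T a ^^ n) \<in> haar a \<rightarrow>\<^sub>M haar a" for n
    by (rule measurable_compose_n[OF Tm])
  have comp: "(\<lambda>\<omega>. \<omega> k = 0) \<in> haar a \<rightarrow>\<^sub>M count_space UNIV" if "1 \<le> k" for k
    unfolding haar_def
    by (rule measurable_compose[OF measurable_component_singleton])
      (use that in \<open>auto simp: measurable_def space_uniform_count_measure sets_uniform_count_measure\<close>)
  have Zm: "Measurable.pred (haar a) (\<lambda>\<omega>. ?Z \<omega> = F)" for F
  proof -
    have "Measurable.pred (haar a) (\<lambda>\<omega>. (1 \<le> k \<and> \<omega> k = 0) = (k \<in> F))" for k
      using comp[of k] by (cases "1 \<le> k") auto
    then have "Measurable.pred (haar a) (\<lambda>\<omega>. \<forall>k. (1 \<le> k \<and> \<omega> k = 0) = (k \<in> F))"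
      by (rule pred_intros_countable)
    moreover have "(\<forall>k. (1 \<le> k \<and> \<omega> k = 0) = (k \<in> F)) = (?Z \<omega> = F)" for \<omega>
      by blast
    ultimately show ?thesis by (simp only:)
  qed
  have eq: "(Delta \<omega> = enat m) = (\<exists>F\<in>{F. finite F \<and> card F = m}. ?Z \<omega> = F)" for \<omega> m
    by (auto simp: Delta_def Let_def)
  have ctb: "countable {F :: nat set. finite F \<and> card F = m}" for m
    by (rule countable_subset[OF _ countable_Collect_finite]) auto
  have D: "Delta \<in> haar a \<rightarrow>\<^sub>M count_space UNIV"
  proof (rule measurable_count_space_eq_countable[THEN iffD2])
    show "countable (UNIV :: enat set)" by simp
    have fin: "Measurable.pred (haar a) (\<lambda>\<omega>. Delta \<omega> = enat m)" for m
    proof -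
      have "{\<omega> \<in> space (haar a). Delta \<omega> = enat m}
          = (\<Union>F\<in>{F. finite F \<and> card F = m}. {\<omega> \<in> space (haar a). ?Z \<omega> = F})"
        unfolding eq by blast
      also have "\<dots> \<in> sets (haar a)"
        using Zm unfolding pred_def by (intro sets.countable_UN'' ctb)
      finally show ?thesis
        unfolding pred_def .
    qed
    have inf: "Measurable.pred (haar a) (\<lambda>\<omega>. Delta \<omega> = \<infinity>)"
    proof -
      have "Measurable.pred (haar a) (\<lambda>\<omega>. \<forall>m. \<not> Delta \<omega> = enat m)"
        by (intro pred_intros_countable pred_intros_logic fin)
      moreover have "(\<forall>m. \<not> Delta \<omega> = enat m) = (Delta \<omega> = \<infinity>)" for \<omega>
        by (cases "Delta \<omega>") auto
      ultimately show ?thesis by (simp only:)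
    qed
    have "Measurable.pred (haar a) (\<lambda>\<omega>. Delta \<omega> = d)" for d
      using fin inf by (cases d) auto
    then show "Delta \<in> space (haar a) \<rightarrow> UNIV \<and> (\<forall>d\<in>UNIV. Delta -` {d} \<inter> space (haar a) \<in> sets (haar a))"
      by (simp add: pred_def vimage_def Int_def conj_commute)
  qed
  have "(\<lambda>\<omega>. (- 1 :: int) ^ the_enat (Delta ((T a ^^ n) \<omega>))) \<in> haar a \<rightarrow>\<^sub>M count_space {- 1, 1}" for n
  proof -
    have "(\<lambda>d. (- 1 :: int) ^ the_enat d) \<in> count_space UNIV \<rightarrow>\<^sub>M count_space {- 1, 1}"
      by (auto simp: measurable_def minus_one_power_iff)
    then show ?thesis
      by (intro measurable_compose[OF measurable_compose[OF Tn D]])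
  qed
  then show ?thesis
    unfolding psi_def[abs_def] Y_measurable_def by (intro measurable_restrict)
qed

end

(*
  Idea: if x(n) denotes the residues of n modulo all a_k, a point of Omega, then S^n pi = psi(x(n)).
  An event that depends on finitely many residues has, by the Chinese remainder theorem, asymptotic
  frequency along x(n) equal to its Haar measure. For finitely many times m, the event that some
  coordinate k > K of T^m vanishes has Haar measure and upper frequency along x(n) at most a
  constant times the tail of sum 1/a_k beyond K; outside it the cylinder event is decided by the first
  K residues. Let K tend to infinity.
*)
theory Submission
  imports Defs "HOL-Number_Theory.Cong"
begin

section \<open>Frequencies of predicates on an initial segment of the naturals\<close>

text \<open>Division by zero makes the value at \<open>N = 0\<close> equal to 0. This agrees with
  the factor \<open>1 / real N\<close> in \<open>generic\<close>, and lets bounds on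
  \<open>freq\<close> be stated for every \<open>N\<close>.\<close>

definition freq :: "(nat \<Rightarrow> bool) \<Rightarrow> nat \<Rightarrow> real" where
  "freq P N = real (card {n. n < N \<and> P n}) / real N"

lemma freq_mono:
  assumes "\<And>n. P n \<Longrightarrow> Q n"
  shows "freq P N \<le> freq Q N"
  unfolding freq_def using assms by (intro divide_right_mono of_nat_mono card_mono) auto

lemma freq_Bex_le:
  assumes "finite I"
  shows "freq (\<lambda>n. \<exists>i\<in>I. P i n) N \<le> (\<Sum>i\<in>I. freq (P i) N)"
proof -
  have "{n. n < N \<and> (\<exists>i\<in>I. P i n)} = (\<Union>i\<in>I. {n. n < N \<and> P i n})"
    by auto
  then have "card {n. n < N \<and> (\<exists>i\<in>I. P i n)} \<le> (\<Sum>i\<in>I. card {n. n < N \<and> P i n})"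
    using card_UN_le[OF assms] by metis
  then show ?thesis
    unfolding freq_def sum_divide_distrib[symmetric] of_nat_sum[symmetric]
    by (intro divide_right_mono of_nat_mono) auto
qed

lemma freq_disjoint_Bex:
  assumes "finite I" and "\<And>i j n. i \<in> I \<Longrightarrow> j \<in> I \<Longrightarrow> P i n \<Longrightarrow> P j n \<Longrightarrow> i = j"
  shows "freq (\<lambda>n. \<exists>i\<in>I. P i n) N = (\<Sum>i\<in>I. freq (P i) N)"
proof -
  have "{n. n < N \<and> (\<exists>i\<in>I. P i n)} = (\<Union>i\<in>I. {n. n < N \<and> P i n})"
    by auto
  then have "card {n. n < N \<and> (\<exists>i\<in>I. P i n)} = (\<Sum>i\<in>I. card {n. n < N \<and> P i n})"
    using assms by (simp, subst card_UN_disjoint) auto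
  then show ?thesis
    unfolding freq_def by (simp add: sum_divide_distrib)
qed

text \<open>Each of the two sets is contained in the other together with the exceptional set, so the
  difference of the counts is bounded in both directions.\<close>

lemma freq_diff_le:
  assumes "\<And>n. \<not> B n \<Longrightarrow> P n = Q n"
  shows "\<bar>freq P N - freq Q N\<bar> \<le> freq B N"
proof -
  have le: "freq P N \<le> freq Q N + freq B N" if "\<And>n. \<not> B n \<Longrightarrow> P n = Q n" for P Q
  proof -
    have "{n. n < N \<and> P n} \<subseteq> {n. n < N \<and> Q n} \<union> {n. n < N \<and> B n}"
      using that by auto
    then have "card {n. n < N \<and> P n} \<le> card ({n. n < N \<and> Q n} \<union> {n. n < N \<and> B n})"
      by (intro card_mono) auto
    also have "\<dots> \<le> card {n. n < N \<and> Q n} + card {n. n < N \<and> B n}"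
      by (rule card_Un_le)
    finally show ?thesis
      unfolding freq_def add_divide_distrib[symmetric] of_nat_add[symmetric]
      by (intro divide_right_mono of_nat_mono) auto
  qed
  show ?thesis
    using le[of P Q] le[of Q P] assms by auto
qed

section \<open>Counting residue classes and multiples\<close>

text \<open>This is the ceiling of \<open>(N - r) / p\<close>, or 0 for \<open>N < r\<close>,
  arranged so that the only subtraction is \<open>p - 1 - r\<close>, which \<open>r < p\<close>
  keeps exact.\<close>

lemma card_mod_eq:
  fixes p r N :: nat
  assumes "r < p"
  shows "card {n. n < N \<and> n mod p = r} = (N + (p - 1 - r)) div p"
proof (induction N)
  case 0
  then show ?case using assms by simp
next
  case (Suc N)
  have "{n. n < Suc N \<and> n mod p = r} =
      (if N mod p = r then insert N else id) {n. n < N \<and> n mod p = r}"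
    by (auto simp: less_Suc_eq)
  then have "card {n. n < Suc N \<and> n mod p = r} =
      (if N mod p = r then Suc else id) (card {n. n < N \<and> n mod p = r})"
    by simp
  also have "\<dots> = (Suc N + (p - 1 - r)) div p"
  proof -
    \<comment> \<open>The quotient grows by one exactly when its new dividend is a multiple of
      \<open>p\<close>; this has to coincide with \<open>N\<close> entering the class of
      \<open>r\<close>.\<close>
    have "Suc (N + (p - 1 - r)) mod p = 0 \<longleftrightarrow> N mod p = r"
    proof -
      have "Suc (N + (p - 1 - r)) = N + (p - r)"
        using assms by simp
      moreover have "(N + (p - r)) mod p = 0 \<longleftrightarrow> [N + (p - r) = r + (p - r)] (mod p)"
        using assms by (simp add: cong_def)
      moreover have "\<dots> \<longleftrightarrow> N mod p = r"
        unfolding cong_add_rcancel_nat using assms by (simp add: cong_def)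
      ultimately show ?thesis by metis
    qed
    then show ?thesis
      by (auto simp: Suc.IH div_Suc)
  qed
  finally show ?case .
qed

lemma freq_mod_eq_tendsto:
  assumes "r < p"
  shows "freq (\<lambda>n. n mod p = r) \<longlonglongrightarrow> 1 / real p"
proof -
  have bd: "norm (freq (\<lambda>n. n mod p = r) N - 1 / real p) \<le> 1 / real N" if "0 < N" for N
  proof -
    \<comment> \<open>The count \<open>c\<close> differs from \<open>N / p\<close> by at most 1;
      dividing by \<open>N\<close> gives the rate.\<close>
    define c where "c = (N + (p - 1 - r)) div p"
    have "p * c \<le> N + (p - 1 - r)" "N + (p - 1 - r) < p * c + p"
      unfolding c_def using assms dividend_less_times_div[of p "N + (p - 1 - r)"] by auto
    then have "p * c \<le> N + p" "N \<le> p * c + p"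
      using assms by auto
    then have "real p * real c \<le> real N + real p" "real N \<le> real p * real c + real p"
      by (metis of_nat_add of_nat_le_iff of_nat_mult)+
    then have "\<bar>real c * real p - real N\<bar> \<le> real p"
      by (simp add: abs_le_iff algebra_simps)
    moreover have "freq (\<lambda>n. n mod p = r) N - 1 / real p = (real c * real p - real N) / (real p * real N)"
      using that assms unfolding freq_def card_mod_eq[OF assms] c_def[symmetric]
      by (simp add: field_simps)
    ultimately show ?thesis
      using that assms by (simp add: abs_mult divide_simps)
  qed
  have "(\<lambda>N. freq (\<lambda>n. n mod p = r) N - 1 / real p) \<longlonglongrightarrow> 0"
    by (rule Lim_null_comparison[OF _ lim_1_over_n])
      (use bd in \<open>auto simp: eventually_sequentially intro!: exI[of _ 1]\<close>)
  then show ?thesis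
    using LIM_zero_cancel by blast
qed

text \<open>The quotient \<open>(n + m) div d\<close> determines \<open>n\<close>. Since
  \<open>1 \<le> m\<close>, it is never 0; for \<open>m = 0\<close> the solution
  \<open>n = 0\<close> would be counted for every \<open>d\<close>, however large.\<close>

lemma card_dvd_le:
  fixes d m N :: nat
  assumes "1 \<le> d" "1 \<le> m"
  shows "real (card {n. n < N \<and> d dvd n + m}) \<le> real (N + m) / real d"
proof -
  have "card {n. n < N \<and> d dvd n + m} \<le> card {1..(N + m) div d}"
  proof (rule card_inj_on_le[where f = "\<lambda>n. (n + m) div d"])
    show "inj_on (\<lambda>n. (n + m) div d) {n. n < N \<and> d dvd n + m}"
      using assms by (auto intro!: inj_onI simp: dvd_div_eq_iff)
    show "(\<lambda>n. (n + m) div d) ` {n. n < N \<and> d dvd n + m} \<subseteq> {1..(N + m) div d}"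
      using assms by (auto simp: div_le_mono Suc_le_eq div_greater_zero_iff dvd_imp_le)
  qed simp
  then have "real (card {n. n < N \<and> d dvd n + m}) \<le> real ((N + m) div d)"
    by simp
  also have "\<dots> \<le> real (N + m) / real d"
    by (rule of_nat_div_le_of_nat)
  finally show ?thesis .
qed

text \<open>A union bound, uniform in \<open>N\<close>. This controls the bad times caused by
  infinitely many moduli, where the limiting frequencies of single moduli would not suffice.\<close>

lemma freq_dvd_le:
  fixes b :: "nat \<Rightarrow> nat"
  assumes b: "\<And>i. 1 \<le> b i" and sm: "summable (\<lambda>i. 1 / real (b i))" and m: "1 \<le> m"
  shows "freq (\<lambda>n. \<exists>i. b i dvd n + m) N \<le> (1 + real m) * (\<Sum>i. 1 / real (b i))"
proof (cases "N = 0")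
  case True
  then show ?thesis
    by (simp add: freq_def suminf_nonneg[OF sm])
next
  case False
  define S where "S = {n. n < N \<and> (\<exists>i. b i dvd n + m)}"
  \<comment> \<open>One divisor index is chosen for each bad \<open>n\<close>. Only finitely many
    indices occur, so a finite union bound applies before comparing with the full series.\<close>
  define w where "w n = (SOME i. b i dvd n + m)" for n
  have fin: "finite (w ` S)"
    by (simp add: S_def)
  have "S \<subseteq> (\<Union>i\<in>w ` S. {n. n < N \<and> b i dvd n + m})"
    unfolding S_def w_def by (auto intro: someI)
  then have "card S \<le> card (\<Union>i\<in>w ` S. {n. n < N \<and> b i dvd n + m})"
    using fin by (intro card_mono finite_UN_I) auto
  also have "\<dots> \<le> (\<Sum>i\<in>w ` S. card {n. n < N \<and> b i dvd n + m})"
    by (rule card_UN_le[OF fin])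
  finally have "real (card S) \<le> (\<Sum>i\<in>w ` S. real (card {n. n < N \<and> b i dvd n + m}))"
    unfolding of_nat_sum[symmetric] by (rule of_nat_mono)
  also have "\<dots> \<le> (\<Sum>i\<in>w ` S. real (N + m) / real (b i))"
    by (intro sum_mono card_dvd_le b m)
  also have "\<dots> = real (N + m) * (\<Sum>i\<in>w ` S. 1 / real (b i))"
    by (simp add: sum_distrib_left)
  also have "\<dots> \<le> real (N + m) * (\<Sum>i. 1 / real (b i))"
    by (intro mult_left_mono sum_le_suminf sm fin) auto
  finally have "freq (\<lambda>n. \<exists>i. b i dvd n + m) N \<le> real (N + m) / real N * (\<Sum>i. 1 / real (b i))"
    using False by (simp add: freq_def S_def divide_right_mono)
  \<comment> \<open>For \<open>N \<ge> 1\<close>, \<open>(N + m) / N\<close> is at most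
    \<open>1 + m\<close>.\<close>
  also have "\<dots> \<le> (1 + real m) * (\<Sum>i. 1 / real (b i))"
    using False mult_right_mono[of 1 "real N" "real m"]
    by (intro mult_right_mono suminf_nonneg sm) (auto simp: field_simps)
  finally show ?thesis .
qed

section \<open>The diagonal orbit in the product of cyclic groups\<close>

locale coprime_moduli =
  fixes a :: "nat \<Rightarrow> nat"
  assumes ge2: "\<And>k. 1 \<le> k \<Longrightarrow> 2 \<le> a k"
    and cop: "pairwise (\<lambda>i j. coprime (a i) (a j)) {1..}"
begin

sublocale haar: prob_space "haar a"
  using ge2 by (rule prob_space_haar)

lemma carrier_factor: "1 \<le> k \<Longrightarrow> carrier (integer_mod_group (a k)) = {0..<int (a k)}"
  using ge2[of k] by (simp add: carrier_integer_mod_group)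

lemma space_haar_eq: "space (haar a) = (\<Pi>\<^sub>E k\<in>{1..}. {0..<int (a k)})"
  by (auto simp: space_haar Omega_def carrier_factor intro!: PiE_cong)

text \<open>The diagonal image of the integer \<open>n\<close>, which is also the
  \<open>n\<close>-th point of the \<open>T a\<close>-orbit of the zero element.\<close>

definition orbit :: "nat \<Rightarrow> nat \<Rightarrow> int" where
  "orbit n = (\<lambda>k\<in>{1..}. int (n mod a k))"

lemma orbit_in_space: "orbit n \<in> space (haar a)"
proof -
  have "n mod a k < a k" if "1 \<le> k" for k
    using ge2[OF that] by simp
  then show ?thesis
    by (auto simp: space_haar_eq orbit_def simp flip: of_nat_mod)
qed

lemma T_power:
  assumes "\<omega> \<in> space (haar a)"
  shows "(T a ^^ m) \<omega> = (\<lambda>k\<in>{1..}. (\<omega> k + int m) mod int (a k))"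
proof (induction m)
  case 0
  \<comment> \<open>With no translation the formula still reduces each coordinate. It returns
    \<open>\<omega>\<close> because points of the space have reduced coordinates and are
    \<open>undefined\<close> at index 0.\<close>
  have "\<omega> k mod int (a k) = \<omega> k" if "1 \<le> k" for k
    using assms that by (auto simp: space_haar_eq PiE_iff)
  moreover have "\<omega> k = undefined" if "\<not> 1 \<le> k" for k
    using assms that by (auto simp: space_haar_eq PiE_iff extensional_def)
  ultimately show ?case
    by (auto simp: restrict_def)
next
  case (Suc m)
  then show ?case
    by (auto simp: T_def restrict_def mod_simps algebra_simps)
qed

lemma T_power_orbit: "(T a ^^ m) (orbit n) = orbit (n + m)"
proof -
  have "(int (n mod a k) + int m) mod int (a k) = int ((n + m) mod a k)" for k
    by (metis mod_add_left_eq of_nat_add of_nat_mod)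
  then show ?thesis
    unfolding T_power[OF orbit_in_space] by (auto simp: orbit_def)
qed

lemma orbit_eq_0_iff: "1 \<le> k \<Longrightarrow> orbit n k = 0 \<longleftrightarrow> a k dvd n"
  by (simp add: orbit_def mod_eq_0_iff_dvd)

text \<open>Coordinate \<open>k\<close> of \<open>orbit (n + m)\<close> vanishes exactly when
  \<open>a k\<close> divides \<open>n + m\<close>, so \<open>Delta\<close> there is
  \<open>delta a (n + m)\<close>. It is finite because \<open>m \<ge> 1\<close> keeps
  \<open>n + m\<close> positive.\<close>

lemma psi_orbit: "psi a (orbit n) = (shift ^^ n) (pi_seq a)"
proof -
  have "Delta (orbit n) = enat (delta a n)" if "1 \<le> n" for n
  proof -
    have "{k. 1 \<le> k \<and> orbit n k = 0} = {k. 1 \<le> k \<and> a k dvd n}"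
      by (auto simp: orbit_eq_0_iff)
    then show ?thesis
      using finite_delta[OF ge2 cop that] by (simp add: Delta_def delta_def)
  qed
  then have "psi a (orbit n) = (\<lambda>m\<in>{1..}. (- 1) ^ delta a (n + m))"
    by (auto simp: psi_def T_power_orbit)
  moreover have "(shift ^^ n) (pi_seq a) = (\<lambda>m\<in>{1..}. (- 1) ^ delta a (n + m))"
    by (induction n) (auto simp: pi_seq_def shift_def restrict_def)
  ultimately show ?thesis by simp
qed

section \<open>Events that depend on finitely many coordinates\<close>

lemma measure_haar_box:
  assumes J: "finite J" "J \<subseteq> {1..}" and x: "\<And>k. k \<in> J \<Longrightarrow> x k \<in> {0..<int (a k)}"
  shows "{\<omega> \<in> space (haar a). \<forall>k\<in>J. \<omega> k = x k} \<in> sets (haar a)"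
    and "measure (haar a) {\<omega> \<in> space (haar a). \<forall>k\<in>J. \<omega> k = x k} = 1 / real (\<Prod>k\<in>J. a k)"
proof -
  let ?U = "\<lambda>k. uniform_count_measure (carrier (integer_mod_group (a k)))"
  have eq: "{\<omega> \<in> space (haar a). \<forall>k\<in>J. \<omega> k = x k} = prod_emb {1..} ?U J (\<Pi>\<^sub>E k\<in>J. {x k})"
    using J by (auto simp: prod_emb_def haar_def space_PiM PiE_iff extensional_def)
  have sts: "{x k} \<in> sets (?U k)" if "k \<in> J" for k
    using that J x[OF that] by (auto simp: sets_uniform_count_measure carrier_factor)
  show "{\<omega> \<in> space (haar a). \<forall>k\<in>J. \<omega> k = x k} \<in> sets (haar a)"
    unfolding eq unfolding haar_def using J sts by (intro sets_PiM_I) auto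
  have "emeasure (haar a) {\<omega> \<in> space (haar a). \<forall>k\<in>J. \<omega> k = x k} = (\<Prod>k\<in>J. emeasure (?U k) {x k})"
    unfolding eq unfolding haar_def using J sts ge2
    by (intro emeasure_PiM_emb prob_space_factor) auto
  also have "\<dots> = (\<Prod>k\<in>J. ennreal (1 / real (a k)))"
  proof (rule prod.cong[OF refl])
    fix k assume k: "k \<in> J"
    then have "carrier (integer_mod_group (a k)) = {0..<int (a k)}"
      using J by (intro carrier_factor) auto
    then show "emeasure (?U k) {x k} = ennreal (1 / real (a k))"
      using x[OF k] by (simp add: emeasure_uniform_count_measure)
  qed
  also have "\<dots> = ennreal (1 / real (\<Prod>k\<in>J. a k))"
    by (subst prod_ennreal) (auto simp: prod_dividef)
  finally show "measure (haar a) {\<omega> \<in> space (haar a). \<forall>k\<in>J. \<omega> k = x k} = 1 / real (\<Prod>k\<in>J. a k)"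
    by (simp add: measure_def prod_nonneg)
qed

text \<open>By the Chinese remainder theorem the prescribed residues amount to a single class modulo
  the product of the moduli. The limit is the Haar measure of the box.\<close>

lemma freq_orbit_box:
  assumes J: "finite J" "J \<subseteq> {1..}" and x: "\<And>k. k \<in> J \<Longrightarrow> x k \<in> {0..<int (a k)}"
  shows "freq (\<lambda>n. \<forall>k\<in>J. orbit n k = x k) \<longlonglongrightarrow> 1 / real (\<Prod>k\<in>J. a k)"
proof -
  have cp: "coprime (a i) (a j)" if "i \<in> J" "j \<in> J" "i \<noteq> j" for i j
    using pairwiseD[OF cop, of i j] that J by auto
  have "\<exists>!r. r < (\<Prod>k\<in>J. a k) \<and> (\<forall>k\<in>J. [r = nat (x k)] (mod a k))"
    using J ge2 cp by (intro chinese_remainder_unique_nat) fastforce+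
  then obtain r where r: "r < (\<Prod>k\<in>J. a k)" "\<And>k. k \<in> J \<Longrightarrow> [r = nat (x k)] (mod a k)"
    by blast
  have "(\<forall>k\<in>J. orbit n k = x k) \<longleftrightarrow> n mod (\<Prod>k\<in>J. a k) = r" for n
  proof -
    have "orbit n k = x k \<longleftrightarrow> [n = r] (mod a k)" if k: "k \<in> J" for k
    proof -
      have "int (n mod a k) = x k \<longleftrightarrow> n mod a k = nat (x k) mod a k"
        using x[OF k] by auto
      moreover have "orbit n k = int (n mod a k)"
        using k J by (auto simp: orbit_def)
      ultimately show ?thesis
        using r(2)[OF k] by (simp add: cong_def)
    qed
    then have "(\<forall>k\<in>J. orbit n k = x k) \<longleftrightarrow> (\<forall>k\<in>J. [n = r] (mod a k))"
      by simp
    also have "\<dots> \<longleftrightarrow> [n = r] (mod (\<Prod>k\<in>J. a k))"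
      using coprime_cong_prod_nat[of J a n r] cp by (auto intro: cong_dvd_modulus_nat dvd_prodI[OF J(1)])
    finally show ?thesis
      using r(1) by (simp add: cong_def)
  qed
  then show ?thesis
    using freq_mod_eq_tendsto[OF r(1)] by simp
qed

text \<open>Such an event is a finite disjoint union of boxes, one for each admissible pattern on
  \<open>J\<close>; measures and limiting frequencies of boxes agree and add up.\<close>

lemma freq_orbit_local:
  assumes J: "finite J" "J \<subseteq> {1..}"
    and loc: "\<And>\<omega> \<omega>'. \<forall>k\<in>J. \<omega> k = \<omega>' k \<Longrightarrow> Q \<omega> \<longleftrightarrow> Q \<omega>'"
  shows "{\<omega> \<in> space (haar a). Q \<omega>} \<in> sets (haar a)"
    and "freq (\<lambda>n. Q (orbit n)) \<longlonglongrightarrow> measure (haar a) {\<omega> \<in> space (haar a). Q \<omega>}"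
proof -
  \<comment> \<open>Here \<open>Q\<close> is evaluated at patterns that are \<open>undefined\<close>
    off \<open>J\<close>. Hence \<open>loc\<close> is assumed for all functions, not only for points
    of the space.\<close>
  define G where "G = {x \<in> (\<Pi>\<^sub>E k\<in>J. {0..<int (a k)}). Q x}"
  let ?B = "\<lambda>x. {\<omega> \<in> space (haar a). \<forall>k\<in>J. \<omega> k = x k}"
  have fin: "finite G"
    unfolding G_def using J by (auto intro!: finite_PiE)
  have G: "x k \<in> {0..<int (a k)}" if "x \<in> G" "k \<in> J" for x k
    using that by (auto simp: G_def PiE_iff)
  have uniq: "x = y" if "x \<in> G" "y \<in> G" "\<forall>k\<in>J. \<omega> k = x k" "\<forall>k\<in>J. \<omega> k = y k" for x y and \<omega> :: "nat \<Rightarrow> int"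
    by (rule PiE_ext[of x J "\<lambda>k. {0..<int (a k)}"]) (use that in \<open>auto simp: G_def\<close>)
  have Q: "Q \<omega> \<longleftrightarrow> (\<exists>x\<in>G. \<forall>k\<in>J. \<omega> k = x k)" if "\<omega> \<in> space (haar a)" for \<omega>
  proof
    assume "Q \<omega>"
    moreover have "Q (restrict \<omega> J) \<longleftrightarrow> Q \<omega>"
      by (rule loc) simp
    ultimately have "restrict \<omega> J \<in> G"
      using that J by (auto simp: G_def space_haar_eq PiE_iff subset_iff)
    then show "\<exists>x\<in>G. \<forall>k\<in>J. \<omega> k = x k"
      by (intro bexI[of _ "restrict \<omega> J"]) auto
  next
    assume "\<exists>x\<in>G. \<forall>k\<in>J. \<omega> k = x k"
    then show "Q \<omega>"
      using loc unfolding G_def by blast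
  qed
  have eq: "{\<omega> \<in> space (haar a). Q \<omega>} = (\<Union>x\<in>G. ?B x)"
    using Q by auto
  have sts: "?B x \<in> sets (haar a)" if "x \<in> G" for x
    using J G that by (intro measure_haar_box) auto
  then show "{\<omega> \<in> space (haar a). Q \<omega>} \<in> sets (haar a)"
    unfolding eq using fin by (intro sets.finite_UN) auto
  have "measure (haar a) {\<omega> \<in> space (haar a). Q \<omega>} = (\<Sum>x\<in>G. measure (haar a) (?B x))"
    unfolding eq
  proof (rule haar.finite_measure_finite_Union[OF fin])
    show "?B ` G \<subseteq> sets (haar a)"
      using sts by auto
    show "disjoint_family_on ?B G"
      unfolding disjoint_family_on_def using uniq by blast
  qed
  also have "\<dots> = (\<Sum>x\<in>G. 1 / real (\<Prod>k\<in>J. a k))"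
    using J G by (intro sum.cong refl measure_haar_box) auto
  finally have mu: "measure (haar a) {\<omega> \<in> space (haar a). Q \<omega>} = (\<Sum>x\<in>G. 1 / real (\<Prod>k\<in>J. a k))" .
  have "(\<lambda>n. Q (orbit n)) = (\<lambda>n. \<exists>x\<in>G. \<forall>k\<in>J. orbit n k = x k)"
    using Q[OF orbit_in_space] by simp
  then have "freq (\<lambda>n. Q (orbit n)) = (\<lambda>N. \<Sum>x\<in>G. freq (\<lambda>n. \<forall>k\<in>J. orbit n k = x k) N)"
    using freq_disjoint_Bex[OF fin, of "\<lambda>x n. \<forall>k\<in>J. orbit n k = x k"] uniq by auto
  moreover have "\<dots> \<longlonglongrightarrow> (\<Sum>x\<in>G. 1 / real (\<Prod>k\<in>J. a k))"
    using J G by (intro tendsto_sum freq_orbit_box) auto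
  ultimately show "freq (\<lambda>n. Q (orbit n)) \<longlonglongrightarrow> measure (haar a) {\<omega> \<in> space (haar a). Q \<omega>}"
    unfolding mu by simp
qed

section \<open>Zeros at large coordinates: measure and frequency\<close>

text \<open>A zero after \<open>m\<close> steps means that coordinate \<open>k\<close> equals the
  residue of \<open>- m\<close>, which is a box on one coordinate.\<close>

lemma measure_T_power_eq_0:
  assumes "1 \<le> k"
  shows "{\<omega> \<in> space (haar a). (T a ^^ m) \<omega> k = 0} \<in> sets (haar a)"
    and "measure (haar a) {\<omega> \<in> space (haar a). (T a ^^ m) \<omega> k = 0} = 1 / real (a k)"
proof -
  have pos: "0 < int (a k)"
    using ge2[OF assms] by simp
  have "(T a ^^ m) \<omega> k = 0 \<longleftrightarrow> \<omega> k = (- int m) mod int (a k)" if "\<omega> \<in> space (haar a)" for \<omega>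
  proof -
    have "\<omega> k mod int (a k) = \<omega> k"
      using that assms by (auto simp: space_haar_eq PiE_iff)
    moreover have "(\<omega> k + int m) mod int (a k) = 0 \<longleftrightarrow> \<omega> k mod int (a k) = (- int m) mod int (a k)"
      using mod_eq_dvd_iff[of "\<omega> k" "int (a k)" "- int m"] by (simp add: mod_eq_0_iff_dvd)
    ultimately show ?thesis
      unfolding T_power[OF that] using assms by simp
  qed
  then have eq: "{\<omega> \<in> space (haar a). (T a ^^ m) \<omega> k = 0}
      = {\<omega> \<in> space (haar a). \<forall>k\<in>{k}. \<omega> k = (- int m) mod int (a k)}"
    by auto
  show "{\<omega> \<in> space (haar a). (T a ^^ m) \<omega> k = 0} \<in> sets (haar a)"
    "measure (haar a) {\<omega> \<in> space (haar a). (T a ^^ m) \<omega> k = 0} = 1 / real (a k)"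
    unfolding eq using measure_haar_box[of "{k}" "\<lambda>k. (- int m) mod int (a k)"] assms pos by simp_all
qed

text \<open>Countable subadditivity over the coordinates beyond \<open>K\<close>, reindexed as
  \<open>i + Suc K\<close>.\<close>

lemma measure_T_power_tail:
  assumes sm: "summable (\<lambda>i. 1 / real (a (i + Suc K)))"
  shows "{\<omega> \<in> space (haar a). \<exists>k>K. (T a ^^ m) \<omega> k = 0} \<in> sets (haar a)"
    and "measure (haar a) {\<omega> \<in> space (haar a). \<exists>k>K. (T a ^^ m) \<omega> k = 0}
      \<le> (\<Sum>i. 1 / real (a (i + Suc K)))"
proof -
  let ?A = "\<lambda>i. {\<omega> \<in> space (haar a). (T a ^^ m) \<omega> (i + Suc K) = 0}"
  have ex: "(\<exists>k>K. P k) \<longleftrightarrow> (\<exists>i. P (i + Suc K))" for P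
    by (metis add.commute add_Suc_shift less_add_Suc1 less_iff_Suc_add add_Suc_right)
  have eq: "{\<omega> \<in> space (haar a). \<exists>k>K. (T a ^^ m) \<omega> k = 0} = (\<Union>i. ?A i)"
    unfolding ex by auto
  have sts: "?A i \<in> sets (haar a)" for i
    by (rule measure_T_power_eq_0) simp
  have mu: "measure (haar a) (?A i) = 1 / real (a (i + Suc K))" for i
    by (rule measure_T_power_eq_0) simp
  show "{\<omega> \<in> space (haar a). \<exists>k>K. (T a ^^ m) \<omega> k = 0} \<in> sets (haar a)"
    unfolding eq using sts by (intro sets.countable_UN) auto
  have "measure (haar a) (\<Union>i. ?A i) \<le> (\<Sum>i. measure (haar a) (?A i))"
    using sts sm by (intro haar.finite_measure_subadditive_countably) (auto simp: mu simp del: add_Suc_right)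
  then show "measure (haar a) {\<omega> \<in> space (haar a). \<exists>k>K. (T a ^^ m) \<omega> k = 0}
      \<le> (\<Sum>i. 1 / real (a (i + Suc K)))"
    unfolding eq mu .
qed

text \<open>The counterpart of the measure bound along the orbit: a zero at \<open>k\<close> says
  that \<open>a k\<close> divides \<open>n + m\<close>. The factor \<open>1 + real m\<close> is the
  price of a bound valid for every \<open>N\<close>.\<close>

lemma freq_orbit_tail:
  assumes sm: "summable (\<lambda>i. 1 / real (a (i + Suc K)))" and m: "1 \<le> m"
  shows "freq (\<lambda>n. \<exists>k>K. orbit (n + m) k = 0) N \<le> (1 + real m) * (\<Sum>i. 1 / real (a (i + Suc K)))"
proof -
  have "freq (\<lambda>n. \<exists>k>K. orbit (n + m) k = 0) N \<le> freq (\<lambda>n. \<exists>i. a (i + Suc K) dvd n + m) N"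
  proof (rule freq_mono)
    fix n assume "\<exists>k>K. orbit (n + m) k = 0"
    then obtain k where k: "k > K" "orbit (n + m) k = 0" by blast
    then have "a ((k - Suc K) + Suc K) dvd n + m"
      using orbit_eq_0_iff[of k "n + m"] by simp
    then show "\<exists>i. a (i + Suc K) dvd n + m" ..
  qed
  also have "\<dots> \<le> (1 + real m) * (\<Sum>i. 1 / real (a (i + Suc K)))"
    by (rule freq_dvd_le[OF _ sm m]) (use ge2[of "_ + Suc K"] in \<open>auto intro: order.trans[of _ 2]\<close>)
  finally show ?thesis .
qed

section \<open>Approximation of the coding map by finitely many coordinates\<close>

text \<open>All zeros lie in \<open>{1..K}\<close>, so \<open>Delta\<close> is finite and
  \<open>the_enat\<close> returns the true count.\<close>

lemma psi_eq_truncated: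
  assumes "\<not> (\<exists>k>K. (T a ^^ m) \<omega> k = 0)" "1 \<le> m"
  shows "psi a \<omega> m = (- 1) ^ card {k \<in> {1..K}. (T a ^^ m) \<omega> k = 0}"
proof -
  have "{k. 1 \<le> k \<and> (T a ^^ m) \<omega> k = 0} = {k \<in> {1..K}. (T a ^^ m) \<omega> k = 0}"
    using assms by (auto simp: not_less)
  then show ?thesis
    using assms by (simp add: psi_def Delta_def)
qed

lemma freq_psi_orbit:
  assumes sm: "summable (\<lambda>k. 1 / real (a k))"
    and F: "finite F" "F \<subseteq> {1..}"
    and meas: "{\<omega> \<in> space (haar a). \<forall>m\<in>F. psi a \<omega> m = v m} \<in> sets (haar a)"
  shows "freq (\<lambda>n. \<forall>m\<in>F. psi a (orbit n) m = v m)
    \<longlonglongrightarrow> measure (haar a) {\<omega> \<in> space (haar a). \<forall>m\<in>F. psi a \<omega> m = v m}"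
proof (rule LIMSEQ_I)
  fix \<epsilon> :: real assume \<epsilon>: "0 < \<epsilon>"
  let ?E = "\<lambda>\<omega>. \<forall>m\<in>F. psi a \<omega> m = v m"
  let ?\<mu> = "\<lambda>Q. measure (haar a) {\<omega> \<in> space (haar a). Q \<omega>}"
  \<comment> \<open>One constant serves two union bounds over \<open>F\<close>: the weights
    \<open>1 + real m\<close> come from the frequency bound, and \<open>card F \<le> c\<close>
    covers the measure bound.\<close>
  define c where "c = (\<Sum>m\<in>F. 1 + real m)"
  have c: "0 \<le> c" "real (card F) \<le> c"
    unfolding c_def by (auto intro!: sum_nonneg add_nonneg_nonneg simp: sum.distrib)
  \<comment> \<open>Using \<open>c + 1\<close> avoids division by zero when \<open>F\<close> is
    empty.\<close>
  obtain K0 where K0: "\<And>K. K \<ge> K0 \<Longrightarrow> norm (\<Sum>i. 1 / real (a (i + K))) < \<epsilon> / (3 * (c + 1))"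
    using suminf_exist_split[OF _ sm, of "\<epsilon> / (3 * (c + 1))"] \<epsilon> c by auto
  define t where "t = (\<Sum>i. 1 / real (a (i + Suc K0)))"
  have smK: "summable (\<lambda>i. 1 / real (a (i + Suc K0)))"
    by (rule summable_ignore_initial_segment[OF sm])
  have t0: "0 \<le> t"
    unfolding t_def by (intro suminf_nonneg smK) simp
  have "t < \<epsilon> / (3 * (c + 1))"
    using K0[of "Suc K0"] by (simp add: t_def)
  then have "(c + 1) * t < \<epsilon> / 3"
    using c by (simp add: field_simps)
  then have ct: "c * t < \<epsilon> / 3"
    using t0 by (simp add: algebra_simps)
  \<comment> \<open>The residue formula replaces the power of \<open>T a\<close>, so that dependence
    on the first \<open>K0\<close> coordinates alone is visible for arbitrary functions.\<close>
  define Q where "Q \<omega> \<longleftrightarrow> (\<forall>m\<in>F. (- 1) ^ card {k \<in> {1..K0}. (\<omega> k + int m) mod int (a k) = 0} = v m)" for \<omega>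
  define B where "B \<omega> \<longleftrightarrow> (\<exists>m\<in>F. \<exists>k>K0. (T a ^^ m) \<omega> k = 0)" for \<omega>
  have EQ: "?E \<omega> \<longleftrightarrow> Q \<omega>" if "\<omega> \<in> space (haar a)" "\<not> B \<omega>" for \<omega>
  proof -
    have "psi a \<omega> m = (- 1) ^ card {k \<in> {1..K0}. (\<omega> k + int m) mod int (a k) = 0}" if m: "m \<in> F" for m
    proof -
      have "\<not> (\<exists>k>K0. (T a ^^ m) \<omega> k = 0)"
        using \<open>\<not> B \<omega>\<close> m by (auto simp: B_def)
      then have "psi a \<omega> m = (- 1) ^ card {k \<in> {1..K0}. (T a ^^ m) \<omega> k = 0}"
        using m F by (intro psi_eq_truncated) auto
      moreover have "{k \<in> {1..K0}. (T a ^^ m) \<omega> k = 0} = {k \<in> {1..K0}. (\<omega> k + int m) mod int (a k) = 0}"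
        unfolding T_power[OF \<open>\<omega> \<in> space (haar a)\<close>] by auto
      ultimately show ?thesis by simp
    qed
    then show ?thesis
      unfolding Q_def by simp
  qed
  have loc: "Q \<omega> \<longleftrightarrow> Q \<omega>'" if "\<forall>k\<in>{1..K0}. \<omega> k = \<omega>' k" for \<omega> \<omega>'
  proof -
    have "{k \<in> {1..K0}. (\<omega> k + int m) mod int (a k) = 0} = {k \<in> {1..K0}. (\<omega>' k + int m) mod int (a k) = 0}" for m
      using that by auto
    then show ?thesis
      unfolding Q_def by simp
  qed
  have Qm: "{\<omega> \<in> space (haar a). Q \<omega>} \<in> sets (haar a)"
    and Qlim: "freq (\<lambda>n. Q (orbit n)) \<longlonglongrightarrow> ?\<mu> Q"
  proof -
    have "{1..K0} \<subseteq> {1..}"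
      by auto
    note local = freq_orbit_local[OF finite_atLeastAtMost this]
    show "{\<omega> \<in> space (haar a). Q \<omega>} \<in> sets (haar a)"
      by (rule local(1)) (rule loc)
    show "freq (\<lambda>n. Q (orbit n)) \<longlonglongrightarrow> ?\<mu> Q"
      by (rule local(2)) (rule loc)
  qed
  have Beq: "{\<omega> \<in> space (haar a). B \<omega>} = (\<Union>m\<in>F. {\<omega> \<in> space (haar a). \<exists>k>K0. (T a ^^ m) \<omega> k = 0})"
    by (auto simp: B_def)
  have Bm: "{\<omega> \<in> space (haar a). B \<omega>} \<in> sets (haar a)"
    unfolding Beq using F by (intro sets.finite_UN measure_T_power_tail smK)
  have "?\<mu> B \<le> (\<Sum>m\<in>F. ?\<mu> (\<lambda>\<omega>. \<exists>k>K0. (T a ^^ m) \<omega> k = 0))"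
    unfolding Beq using measure_T_power_tail(1)[OF smK]
    by (intro haar.finite_measure_subadditive_finite F(1) image_subsetI)
  also have "\<dots> \<le> (\<Sum>m\<in>F. t)"
    unfolding t_def by (intro sum_mono measure_T_power_tail(2) smK)
  also have "\<dots> \<le> c * t"
    using c t0 by (simp add: mult_right_mono)
  finally have muB: "?\<mu> B \<le> c * t" .
  have muEQ: "\<bar>?\<mu> ?E - ?\<mu> Q\<bar> \<le> ?\<mu> B"
  proof -
    \<comment> \<open>Monotonicity needs the larger set measurable. Both events take the role of
      \<open>R\<close>, which is where \<open>meas\<close> and \<open>Qm\<close> enter.\<close>
    have le: "?\<mu> P \<le> ?\<mu> R + ?\<mu> B"
      if "{\<omega> \<in> space (haar a). R \<omega>} \<in> sets (haar a)" "\<And>\<omega>. \<omega> \<in> space (haar a) \<Longrightarrow> P \<omega> \<Longrightarrow> R \<omega> \<or> B \<omega>" for P R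
    proof -
      have "?\<mu> P \<le> measure (haar a) ({\<omega> \<in> space (haar a). R \<omega>} \<union> {\<omega> \<in> space (haar a). B \<omega>})"
        using that Bm by (intro haar.finite_measure_mono) auto
      also have "\<dots> \<le> ?\<mu> R + ?\<mu> B"
        using that Bm by (intro measure_Un_le) auto
      finally show ?thesis .
    qed
    show ?thesis
      using le[of Q ?E] le[of ?E Q] Qm meas EQ by fastforce
  qed
  have freqB: "freq (\<lambda>n. B (orbit n)) N \<le> c * t" for N
  proof -
    have "freq (\<lambda>n. B (orbit n)) N \<le> (\<Sum>m\<in>F. freq (\<lambda>n. \<exists>k>K0. orbit (n + m) k = 0) N)"
      unfolding B_def T_power_orbit by (rule freq_Bex_le[OF F(1)])
    also have "\<dots> \<le> (\<Sum>m\<in>F. (1 + real m) * t)"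
      unfolding t_def using F by (intro sum_mono freq_orbit_tail smK) auto
    finally show ?thesis
      by (simp add: c_def sum_distrib_right)
  qed
  obtain N0 where N0: "\<And>N. N \<ge> N0 \<Longrightarrow> norm (freq (\<lambda>n. Q (orbit n)) N - ?\<mu> Q) < \<epsilon> / 3"
    using LIMSEQ_D[OF Qlim, of "\<epsilon> / 3"] \<epsilon> by auto
  have "norm (freq (\<lambda>n. ?E (orbit n)) N - ?\<mu> ?E) < \<epsilon>" if "N \<ge> N0" for N
  proof -
    \<comment> \<open>Replacing the event by \<open>Q\<close> costs at most \<open>c * t\<close> in
      frequency and \<open>c * t\<close> in measure. With the error of \<open>Q\<close> itself this
      makes three terms below \<open>\<epsilon> / 3\<close>.\<close>
    have "\<bar>freq (\<lambda>n. ?E (orbit n)) N - freq (\<lambda>n. Q (orbit n)) N\<bar> \<le> freq (\<lambda>n. B (orbit n)) N"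
      by (rule freq_diff_le) (rule EQ[OF orbit_in_space])
    then show ?thesis
      using N0[OF that] freqB[of N] muEQ muB ct unfolding real_norm_def by linarith
  qed
  then show "\<exists>no. \<forall>N\<ge>no. norm (freq (\<lambda>n. ?E (orbit n)) N - ?\<mu> ?E) < \<epsilon>"
    by blast
qed

section \<open>Genericity\<close>

text \<open>This includes points with infinite \<open>Delta\<close>: whatever number
  \<open>the_enat\<close> returns, a power of -1 is 1 or -1.\<close>

lemma psi_in_Y: "psi a \<omega> \<in> Y"
  by (auto simp: psi_def Y_def minus_one_power_iff)

text \<open>The preimage of a cylinder under \<open>psi a\<close> is an event of the kind treated in
  \<open>freq_psi_orbit\<close>, and \<open>psi_orbit\<close> turns the average of indicators into
  its frequency along the orbit.\<close>

lemma generic_pi_seq: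
  assumes sm: "summable (\<lambda>k. 1 / real (a k))"
  shows "generic (pi_seq a) (nu a)"
  unfolding generic_def
proof (intro allI impI)
  fix C assume "cylinder C"
  then obtain F v where F: "finite F" "F \<subseteq> {1..}" "\<And>m. m \<in> F \<Longrightarrow> v m \<in> {- 1, 1}"
    and C: "C = {y \<in> Y. \<forall>m\<in>F. y m = v m}"
    by (auto simp: cylinder_def)
  have "C = prod_emb {1..} (\<lambda>_. count_space {- 1, 1}) F (\<Pi>\<^sub>E m\<in>F. {v m})"
    using F by (auto simp: C Y_def prod_emb_def PiE_iff extensional_def)
  then have Cm: "C \<in> sets Y_measurable"
    unfolding Y_measurable_def using F by (auto intro!: sets_PiM_I)
  note psi = psi_measurable[of a, OF ge2]
  have eq: "psi a -` C \<inter> space (haar a) = {\<omega> \<in> space (haar a). \<forall>m\<in>F. psi a \<omega> m = v m}"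
    using psi_in_Y by (auto simp: C)
  have "{\<omega> \<in> space (haar a). \<forall>m\<in>F. psi a \<omega> m = v m} \<in> sets (haar a)"
    using measurable_sets[OF psi Cm] by (simp add: eq)
  then have lim: "freq (\<lambda>n. \<forall>m\<in>F. psi a (orbit n) m = v m)
      \<longlonglongrightarrow> measure (haar a) {\<omega> \<in> space (haar a). \<forall>m\<in>F. psi a \<omega> m = v m}"
    using sm F by (intro freq_psi_orbit)
  have "measure (nu a) C = measure (haar a) {\<omega> \<in> space (haar a). \<forall>m\<in>F. psi a \<omega> m = v m}"
    unfolding nu_def by (simp add: measure_distr[OF psi Cm] eq)
  moreover have "(1 / real N) * (\<Sum>n<N. indicator C ((shift ^^ n) (pi_seq a)))
      = freq (\<lambda>n. \<forall>m\<in>F. psi a (orbit n) m = v m) N" for N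
  proof -
    have "indicator C ((shift ^^ n) (pi_seq a)) = (of_bool (\<forall>m\<in>F. psi a (orbit n) m = v m) :: real)" for n
      using psi_in_Y by (simp add: psi_orbit[symmetric] C indicator_def)
    moreover have "{..<N} \<inter> {n. P n} = {n. n < N \<and> P n}" for P
      by auto
    ultimately show ?thesis
      by (simp add: freq_def)
  qed
  ultimately show "(\<lambda>N. (1 / real N) * (\<Sum>n<N. indicator C ((shift ^^ n) (pi_seq a)))) \<longlonglongrightarrow> measure (nu a) C"
    using lim by simp
qed

end

theorem theorem6p2:
  fixes a :: "nat \<Rightarrow> nat"
  assumes "\<And>k. 1 \<le> k \<Longrightarrow> 2 \<le> a k"
    and "pairwise (\<lambda>i j. coprime (a i) (a j)) {1..}"
    and "(\<lambda>k. 1 / real (a k)) summable_on {1..}"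
  shows "generic (pi_seq a) (nu a)"
proof -
  interpret coprime_moduli a
    by unfold_locales (use assms in auto)
  \<comment> \<open>The value \<open>a 0\<close> is unconstrained, but a single extra term does not
    affect summability, so the series may be taken over all naturals.\<close>
  have "(\<lambda>k. 1 / real (a k)) summable_on insert 0 {1..}"
    using assms(3) by (simp add: summable_on_insert_iff)
  moreover have "insert 0 {1..} = (UNIV :: nat set)"
    by auto
  ultimately have "summable (\<lambda>k. 1 / real (a k))"
    using summable_on_imp_summable by metis
  then show ?thesis
    by (rule generic_pi_seq)
qed

end
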